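(* Let $(\mathcal{J},\mathfrak{Q},\overline{\mu})$ be a finite measure space (with $\overline{\mu}$ a positive, complete measure) and let $X$ be a Banach space. Let $HK(X,\overline{\mu})$ be the space of all Henstock-Kurzweil integrable functions $\xi:\mathcal{J}\to X$, with $\|\xi\|_{\mathfrak{Y}}=\sup\{\|S(\xi,\widehat{D})\| : \widehat{D}\in\mathfrak{Y}\}$. Then $\big(HK(X,\overline{\mu}),\|\cdot\|_{\mathfrak{Y}}\big)$ is complete.
   Context: A sub-partition of $\mathcal{J}$ is a finite collection $D=\{D_i : i=1,\dots,n\}$ of pairwise disjoint nonempty elements of $\mathfrak{Q}$ contained in $\mathcal{J}$. A tagged sub-partition is $\widehat{D}=\{(D_i,d_i): i=1,\dots,n\}$ with $D$ a sub-partition and $d_i\in D_i$ for each $i$; $\mathfrak{Y}$ is the collection of all tagged sub-partitions of $\mathcal{J}$. It is directed by refinement: $\widehat{D}\gg\widehat{D}_0$ means that every member of $D_0$ is a union of members of $D$. For $\xi:\mathcal{J}\to X$ the Riemann sum is $S(\xi,\widehat{D})=\sum_{i=1}^n \xi(d_i)\,\overline{\mu}(D_i)$. The function $\xi:\mathcal{J}\to X$ is Henstock-Kurzweil integrable if there is an element $I\in X$, denoted $\int_{\mathcal{J}}\xi\,d\overline{\mu}$, such that for every $\epsilon>0$ there exists $\widehat{D}_0\in\mathfrak{Y}$ with $\|S(\xi,\widehat{D})-I\|\le\epsilon$ for all $\widehat{D}\in\mathfrak{Y}$ with $\widehat{D}\gg\widehat{D}_0$. *)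

theory Defs
  imports "HOL-Analysis.Analysis"
begin

text \<open>
  A measure space \<open>(\<J>, \<QQ>, \<mu>)\<close> is \<open>M\<close> with \<open>\<J> = space M\<close>, \<open>\<QQ> = sets M\<close>. Functions on \<open>\<J>\<close> are
  total functions; every notion below looks only at their values on \<open>space M\<close>.
\<close>

definition sub_partition :: "'a measure \<Rightarrow> 'a set set \<Rightarrow> bool" where
  "sub_partition M D \<longleftrightarrow> finite D \<and> D \<subseteq> sets M \<and> {} \<notin> D \<and> disjoint D"

text \<open>A tagged sub-partition is a set of pairs; injectivity of \<open>fst\<close> gives each member exactly one tag.\<close>

definition tagged_sub_partitions :: "'a measure \<Rightarrow> ('a set \<times> 'a) set set" where
  "tagged_sub_partitions M =
     {P. sub_partition M (fst ` P) \<and> inj_on fst P \<and> (\<forall>(A, x)\<in>P. x \<in> A)}"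

definition refines :: "('a set \<times> 'a) set \<Rightarrow> ('a set \<times> 'a) set \<Rightarrow> bool" where
  "refines P P0 \<longleftrightarrow> (\<forall>A\<in>fst ` P0. \<exists>C\<subseteq>fst ` P. A = \<Union>C)"

definition riemann_sum ::
    "'a measure \<Rightarrow> ('a \<Rightarrow> 'b) \<Rightarrow> ('a set \<times> 'a) set \<Rightarrow> 'b::real_normed_vector" where
  "riemann_sum M \<xi> P = (\<Sum>(A, x)\<in>P. measure M A *\<^sub>R \<xi> x)"

definition has_HK_integral ::
    "'a measure \<Rightarrow> ('a \<Rightarrow> 'b::real_normed_vector) \<Rightarrow> 'b \<Rightarrow> bool" where
  "has_HK_integral M \<xi> I \<longleftrightarrow>
     (\<forall>\<epsilon>>0. \<exists>P0\<in>tagged_sub_partitions M. \<forall>P\<in>tagged_sub_partitions M.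
        refines P P0 \<longrightarrow> norm (riemann_sum M \<xi> P - I) \<le> \<epsilon>)"

definition HK_space :: "'a measure \<Rightarrow> ('a \<Rightarrow> 'b::real_normed_vector) set" where
  "HK_space M = {\<xi>. \<exists>I. has_HK_integral M \<xi> I}"

text \<open>
  The supremum is taken in \<open>ennreal\<close> because it can be infinite on \<open>HK_space M\<close>: a function that
  is unbounded on a null set and zero elsewhere is integrable, while \<open>{(space M, x)}\<close> may be tagged
  at any point of that null set.
\<close>

definition HK_norm :: "'a measure \<Rightarrow> ('a \<Rightarrow> 'b::real_normed_vector) \<Rightarrow> ennreal" where
  "HK_norm M \<xi> = (SUP P\<in>tagged_sub_partitions M. ennreal (norm (riemann_sum M \<xi> P)))"

text \<open>Completeness of a set of vectors for a possibly infinite (semi)norm \<open>N\<close>.\<close>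

definition Cauchy_wrt :: "('v::minus \<Rightarrow> ennreal) \<Rightarrow> (nat \<Rightarrow> 'v) \<Rightarrow> bool" where
  "Cauchy_wrt N u \<longleftrightarrow> (\<forall>\<epsilon>>0. \<exists>K. \<forall>m\<ge>K. \<forall>n\<ge>K. N (u m - u n) < \<epsilon>)"

definition complete_wrt :: "('v::minus \<Rightarrow> ennreal) \<Rightarrow> 'v set \<Rightarrow> bool" where
  "complete_wrt N V \<longleftrightarrow>
     (\<forall>u. range u \<subseteq> V \<and> Cauchy_wrt N u \<longrightarrow> (\<exists>l\<in>V. (\<lambda>n. N (u n - l)) \<longlonglongrightarrow> 0))"

end

theory Submission
  imports Defs
begin

text \<open>
  Testing the norm on the single tagged set \<open>(A, x)\<close> shows that a Cauchy sequence of functions is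
  Cauchy at every point \<open>x\<close> lying in some set \<open>A\<close> of nonzero measure; values at other points
  contribute 0 to every Riemann sum. Hence Riemann sums of the sequence converge, uniformly over all tagged
  sub-partitions, to those of the pointwise limit. Since any two tagged sub-partitions have a common
  refinement, the integrals form a Cauchy sequence, and its limit is the integral of the
  pointwise limit.
\<close>

section \<open>Riemann sums and tagged sub-partitions\<close>

lemma riemann_sum_diff:
  "riemann_sum M (f - g) P = riemann_sum M f P - riemann_sum M g P"
  unfolding riemann_sum_def
  by (simp add: sum_subtractf[symmetric] case_prod_unfold scaleR_diff_right)

lemma norm_riemann_sum_le_HK_norm:
  "P \<in> tagged_sub_partitions M \<Longrightarrow> ennreal (norm (riemann_sum M \<xi> P)) \<le> HK_norm M \<xi>"
  unfolding HK_norm_def by (rule SUP_upper)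

lemma singleton_in_tagged_sub_partitions:
  "A \<in> sets M \<Longrightarrow> x \<in> A \<Longrightarrow> {(A, x)} \<in> tagged_sub_partitions M"
  by (auto simp: tagged_sub_partitions_def sub_partition_def)

lemma tagged_sub_partitionsD:
  assumes "P \<in> tagged_sub_partitions M" "(A, x) \<in> P"
  shows "A \<in> sets M" "x \<in> A"
proof -
  have "A \<in> fst ` P"
    using assms(2) by (rule image_eqI[rotated]) simp
  with assms show "A \<in> sets M" "x \<in> A"
    unfolding tagged_sub_partitions_def sub_partition_def by blast+
qed

section \<open>Construction of common refinements\<close>

lemma sub_partition_tagged:
  assumes "sub_partition M D"
  obtains P where "P \<in> tagged_sub_partitions M" "fst ` P = D"
proof
  \<comment> \<open>Any tags will do, because \<open>refines\<close> looks only at the sets. They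
    exist because members of a sub-partition are nonempty.\<close>
  let ?P = "(\<lambda>A. (A, SOME x. x \<in> A)) ` D"
  show fst: "fst ` ?P = D"
    by (simp add: image_image)
  have "(SOME x. x \<in> A) \<in> A" if "A \<in> D" for A
    using assms that by (auto simp: sub_partition_def some_in_eq)
  with assms show "?P \<in> tagged_sub_partitions M"
    unfolding tagged_sub_partitions_def mem_Collect_eq fst
    by (auto simp: inj_on_def)
qed

text \<open>Serves to make two sub-partitions comparable by letting both cover the space. The
  remainder may be empty, so \<open>D'\<close> need not itself be a sub-partition.\<close>

lemma sub_partition_insert_rest:
  assumes "sub_partition M D"
  defines "D' \<equiv> insert (space M - \<Union>D) D"
  shows "finite D'" "D' \<subseteq> sets M" "disjoint D'" "\<Union>D' = space M"
proof -
  have D: "finite D" "D \<subseteq> sets M" "disjoint D"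
    using assms(1) by (auto simp: sub_partition_def)
  then show "finite D'" "D' \<subseteq> sets M"
    by (auto simp: D'_def)
  show "disjoint D'"
    using D(3) by (auto simp: D'_def disjoint_def)
  show "\<Union>D' = space M"
    using subset_trans[OF D(2) sets.space_closed] by (auto simp: D'_def)
qed

text \<open>The refinement consists of pairwise intersections. Both families are completed first: a
  member of \<open>P\<close> may contain points outside every member of \<open>Q\<close>, and
  intersections with members of \<open>Q\<close> alone would miss them.\<close>

lemma common_refinement:
  assumes "P \<in> tagged_sub_partitions M" "Q \<in> tagged_sub_partitions M"
  obtains R where "R \<in> tagged_sub_partitions M" "refines R P" "refines R Q"
proof -
  define D E where "D = insert (space M - \<Union>(fst ` P)) (fst ` P)"
    and "E = insert (space M - \<Union>(fst ` Q)) (fst ` Q)"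
  have "sub_partition M (fst ` P)" "sub_partition M (fst ` Q)"
    using assms by (simp_all add: tagged_sub_partitions_def)
  note D = sub_partition_insert_rest[OF this(1), folded D_def]
    and E = sub_partition_insert_rest[OF this(2), folded E_def]
  \<comment> \<open>Removing the empty set also disposes of empty remainders.\<close>
  define F where "F = (\<lambda>(A, B). A \<inter> B) ` (D \<times> E) - {{}}"
  have "sub_partition M F"
    unfolding sub_partition_def
  proof (intro conjI)
    show "finite F" "{} \<notin> F" "F \<subseteq> sets M"
      using D(1,2) E(1,2) by (auto simp: F_def)
    show "disjoint F"
    proof (rule disjointI)
      fix X Y assume "X \<in> F" "Y \<in> F" "X \<noteq> Y"
      then obtain A B A' B' where "X = A \<inter> B" "Y = A' \<inter> B'" "A \<in> D" "A' \<in> D" "B \<in> E" "B' \<in> E"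
        by (auto simp: F_def)
      with \<open>X \<noteq> Y\<close> show "X \<inter> Y = {}"
        using disjointD[OF D(3), of A A'] disjointD[OF E(3), of B B'] by (cases "A = A'") auto
    qed
  qed
  then obtain R where R: "R \<in> tagged_sub_partitions M" "fst ` R = F"
    by (rule sub_partition_tagged)
  have F: "A \<inter> B \<in> F" if "A \<in> D" "B \<in> E" "x \<in> A" "x \<in> B" for A B x
    using that by (auto simp: F_def)
  \<comment> \<open>Reduces refinement to a pointwise check; the witness collects all members of
    \<open>F\<close> inside \<open>A\<close>.\<close>
  have union: "\<exists>C\<subseteq>F. A = \<Union>C" if "\<And>x. x \<in> A \<Longrightarrow> \<exists>X\<in>F. x \<in> X \<and> X \<subseteq> A" for A
  proof (intro exI conjI)
    show "{X \<in> F. X \<subseteq> A} \<subseteq> F" "A = \<Union>{X \<in> F. X \<subseteq> A}"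
      using that by blast+
  qed
  have "refines R P"
    unfolding refines_def R(2)
  proof (intro ballI union)
    fix A x assume "A \<in> fst ` P" "x \<in> A"
    then have A: "A \<in> D"
      by (simp add: D_def)
    \<comment> \<open>Both completed families have union \<open>space M\<close>, so some
      \<open>B\<close> in \<open>E\<close> contains \<open>x\<close>, and the piece sought is
      \<open>A \<inter> B\<close>.\<close>
    then have "x \<in> \<Union>E"
      using UnionI[OF A \<open>x \<in> A\<close>] by (simp only: D(4) E(4))
    then obtain B where B: "B \<in> E" "x \<in> B"
      by blast
    show "\<exists>X\<in>F. x \<in> X \<and> X \<subseteq> A"
      using \<open>x \<in> A\<close> B(2) by (intro bexI[OF _ F[OF A B(1) \<open>x \<in> A\<close> B(2)]]) simp
  qed
  moreover have "refines R Q"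
    unfolding refines_def R(2)
  proof (intro ballI union)
    fix B x assume "B \<in> fst ` Q" "x \<in> B"
    then have B: "B \<in> E"
      by (simp add: E_def)
    then have "x \<in> \<Union>D"
      using UnionI[OF B \<open>x \<in> B\<close>] by (simp only: D(4) E(4))
    then obtain A where A: "A \<in> D" "x \<in> A"
      by blast
    show "\<exists>X\<in>F. x \<in> X \<and> X \<subseteq> B"
      using A(2) \<open>x \<in> B\<close> by (intro bexI[OF _ F[OF A(1) B A(2) \<open>x \<in> B\<close>]]) simp
  qed
  ultimately show thesis
    using R(1) that by blast
qed

section \<open>Integrals under uniform convergence of Riemann sums\<close>

lemma has_HK_integral_dist_le:
  assumes "has_HK_integral M f I" "has_HK_integral M g J"
    and close: "\<And>P. P \<in> tagged_sub_partitions M \<Longrightarrow>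
      norm (riemann_sum M f P - riemann_sum M g P) \<le> e"
  shows "norm (I - J) \<le> e"
proof (rule field_le_epsilon)
  fix d :: real assume "0 < d"
  then have "0 < d / 2" by simp
  then obtain P Q where PQ: "P \<in> tagged_sub_partitions M" "Q \<in> tagged_sub_partitions M"
    and P: "\<And>R. R \<in> tagged_sub_partitions M \<Longrightarrow> refines R P \<Longrightarrow> norm (riemann_sum M f R - I) \<le> d / 2"
    and Q: "\<And>R. R \<in> tagged_sub_partitions M \<Longrightarrow> refines R Q \<Longrightarrow> norm (riemann_sum M g R - J) \<le> d / 2"
    using assms(1,2) unfolding has_HK_integral_def by metis
  \<comment> \<open>On a common refinement both sums are close to their integrals and can be
    compared with each other over the same \<open>R\<close>.\<close>
  obtain R where R: "R \<in> tagged_sub_partitions M" "refines R P" "refines R Q"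
    using PQ by (rule common_refinement)
  have "I - J = (riemann_sum M f R - riemann_sum M g R) - (riemann_sum M f R - I) + (riemann_sum M g R - J)"
    by simp
  also have "norm \<dots> \<le> e + d / 2 + d / 2"
    by (intro norm_triangle_mono norm_triangle_le_diff add_mono close P Q R)
  finally show "norm (I - J) \<le> e + d" by simp
qed

text \<open>An exchange of limits: uniformity over all tagged sub-partitions makes the integrals
  Cauchy, and completeness of the Banach space supplies the candidate value.\<close>

lemma has_HK_integral_uniform_limit:
  fixes u :: "nat \<Rightarrow> 'a \<Rightarrow> 'b::banach"
  assumes int: "\<And>n. has_HK_integral M (u n) (I n)"
    and lim: "uniform_limit (tagged_sub_partitions M) (\<lambda>n. riemann_sum M (u n)) (riemann_sum M l) sequentially"
  shows "\<exists>J. has_HK_integral M l J"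
proof -
  have close: "\<exists>K. \<forall>n\<ge>K. \<forall>P\<in>tagged_sub_partitions M.
      norm (riemann_sum M (u n) P - riemann_sum M l P) < e" if "e > 0" for e
    using uniform_limitD[OF lim that] by (simp add: eventually_sequentially dist_norm)
  have "Cauchy I"
  proof (rule CauchyI)
    fix e :: real assume "0 < e"
    then obtain K where K: "\<And>n P. n \<ge> K \<Longrightarrow> P \<in> tagged_sub_partitions M \<Longrightarrow>
        norm (riemann_sum M (u n) P - riemann_sum M l P) < e / 4"
      \<comment> \<open>Two errors of \<open>e / 4\<close> bound the integrals' distance by
        \<open>e / 2\<close>, which turns a weak inequality into the strict one required.\<close>
      using close[of "e / 4"] by auto
    have "norm (I m - I n) < e" if "m \<ge> K" "n \<ge> K" for m n
    proof -
      have "norm (I m - I n) \<le> e / 2"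
      proof (rule has_HK_integral_dist_le[OF int int])
        fix P assume "P \<in> tagged_sub_partitions M"
        from K[OF \<open>m \<ge> K\<close> this] K[OF \<open>n \<ge> K\<close> this]
        show "norm (riemann_sum M (u m) P - riemann_sum M (u n) P) \<le> e / 2"
          by norm
      qed
      with \<open>0 < e\<close> show ?thesis by simp
    qed
    then show "\<exists>K. \<forall>m\<ge>K. \<forall>n\<ge>K. norm (I m - I n) < e"
      by blast
  qed
  then obtain J where J: "I \<longlonglongrightarrow> J"
    by (auto simp: Cauchy_convergent_iff convergent_def)
  have "has_HK_integral M l J"
    unfolding has_HK_integral_def
  proof (intro allI impI)
    fix e :: real assume "0 < e"
    then have e3: "0 < e / 3" by simp
    \<comment> \<open>The index \<open>n\<close> is fixed before \<open>P0\<close> is chosen; this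
      is possible because the first estimate is uniform in \<open>P\<close>.\<close>
    from close[OF e3] LIMSEQ_D[OF J e3] obtain n
      where u: "\<And>P. P \<in> tagged_sub_partitions M \<Longrightarrow>
          norm (riemann_sum M (u n) P - riemann_sum M l P) < e / 3"
        and n: "norm (I n - J) < e / 3"
      by (metis linorder_linear order_refl)
    obtain P0 where P0: "P0 \<in> tagged_sub_partitions M"
      and P: "\<And>P. P \<in> tagged_sub_partitions M \<Longrightarrow> refines P P0 \<Longrightarrow>
        norm (riemann_sum M (u n) P - I n) \<le> e / 3"
      using int[of n] e3 unfolding has_HK_integral_def by metis
    have "norm (riemann_sum M l P - J) \<le> e"
      if "P \<in> tagged_sub_partitions M" "refines P P0" for P
      using u[OF that(1)] n P[OF that] by norm
    with P0 show "\<exists>P0\<in>tagged_sub_partitions M. \<forall>P\<in>tagged_sub_partitions M.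
        refines P P0 \<longrightarrow> norm (riemann_sum M l P - J) \<le> e"
      by blast
  qed
  then show ?thesis ..
qed

section \<open>Limits of Cauchy sequences\<close>

lemma Cauchy_riemann_sum:
  assumes "Cauchy_wrt (HK_norm M) u" "P \<in> tagged_sub_partitions M"
  shows "Cauchy (\<lambda>n. riemann_sum M (u n) P)"
proof (rule CauchyI)
  fix e :: real assume "0 < e"
  then obtain K where K: "\<And>m n. m \<ge> K \<Longrightarrow> n \<ge> K \<Longrightarrow> HK_norm M (u m - u n) < ennreal e"
    using assms(1) unfolding Cauchy_wrt_def by (metis ennreal_less_zero_iff)
  have "norm (riemann_sum M (u m) P - riemann_sum M (u n) P) < e" if "m \<ge> K" "n \<ge> K" for m n
    using le_less_trans[OF norm_riemann_sum_le_HK_norm[OF assms(2)] K[OF that]]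
    by (simp add: riemann_sum_diff ennreal_less_iff)
  then show "\<exists>K. \<forall>m\<ge>K. \<forall>n\<ge>K. norm (riemann_sum M (u m) P - riemann_sum M (u n) P) < e"
    by blast
qed

lemma riemann_sum_tendsto_pointwise_lim:
  fixes u :: "nat \<Rightarrow> 'a \<Rightarrow> 'b::banach"
  assumes "Cauchy_wrt (HK_norm M) u" "P \<in> tagged_sub_partitions M"
  shows "(\<lambda>n. riemann_sum M (u n) P) \<longlonglongrightarrow> riemann_sum M (\<lambda>x. lim (\<lambda>n. u n x)) P"
  unfolding riemann_sum_def
proof (rule tendsto_sum, clarify)
  fix A x assume "(A, x) \<in> P"
  then have "{(A, x)} \<in> tagged_sub_partitions M"
    using tagged_sub_partitionsD[OF assms(2)] singleton_in_tagged_sub_partitions by metis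
  from Cauchy_riemann_sum[OF assms(1) this]
  obtain y where y: "(\<lambda>n. measure M A *\<^sub>R u n x) \<longlonglongrightarrow> y"
    by (auto simp: riemann_sum_def Cauchy_convergent_iff convergent_def)
  show "(\<lambda>n. measure M A *\<^sub>R u n x) \<longlonglongrightarrow> measure M A *\<^sub>R lim (\<lambda>n. u n x)"
  \<comment> \<open>A nonzero weight can be divided out, so \<open>u n x\<close> converges. For zero
    weight \<open>lim\<close> may be an unspecified value, but both sides are 0.\<close>
  proof (cases "measure M A = 0")
    case False
    with tendsto_scaleR[OF tendsto_const[of "inverse (measure M A)"] y]
    have "convergent (\<lambda>n. u n x)"
      by (auto simp: convergent_def)
    then show ?thesis
      by (intro tendsto_intros) (simp add: convergent_LIMSEQ_iff)
  qed simp
qed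

text \<open>For each fixed \<open>P\<close> the Cauchy estimate survives letting \<open>m\<close>
  tend to infinity. The threshold \<open>K\<close> does not depend on \<open>P\<close>, so the
  supremum can be taken afterwards.\<close>

lemma HK_norm_diff_tendsto_0:
  assumes cauchy: "Cauchy_wrt (HK_norm M) u"
    and lim: "\<And>P. P \<in> tagged_sub_partitions M \<Longrightarrow>
      (\<lambda>n. riemann_sum M (u n) P) \<longlonglongrightarrow> riemann_sum M l P"
  shows "(\<lambda>n. HK_norm M (u n - l)) \<longlonglongrightarrow> 0"
proof (rule order_tendstoI)
  fix e :: ennreal assume "0 < e"
  \<comment> \<open>Limits and suprema preserve only weak bounds; the gap between \<open>d\<close>
    and \<open>e\<close> restores strictness.\<close>
  then obtain d where d: "0 < d" "d < e"
    using dense by blast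
  then obtain K where K: "\<And>m n. m \<ge> K \<Longrightarrow> n \<ge> K \<Longrightarrow> HK_norm M (u m - u n) < d"
    using cauchy unfolding Cauchy_wrt_def by blast
  have "HK_norm M (u n - l) \<le> d" if "n \<ge> K" for n
    unfolding HK_norm_def
  proof (rule SUP_least)
    fix P assume P: "P \<in> tagged_sub_partitions M"
    have "(\<lambda>m. ennreal (norm (riemann_sum M (u n - u m) P)))
        \<longlonglongrightarrow> ennreal (norm (riemann_sum M (u n - l) P))"
      unfolding riemann_sum_diff by (intro tendsto_intros tendsto_ennrealI lim P)
    moreover have "\<forall>m\<ge>K. ennreal (norm (riemann_sum M (u n - u m) P)) \<le> d"
      using K[OF \<open>n \<ge> K\<close>] norm_riemann_sum_le_HK_norm[OF P]
      by (meson le_less_trans less_imp_le)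
    ultimately show "ennreal (norm (riemann_sum M (u n - l) P)) \<le> d"
      by (rule Lim_bounded)
  qed
  then show "\<forall>\<^sub>F n in sequentially. HK_norm M (u n - l) < e"
    using d(2) by (auto simp: eventually_sequentially intro: le_less_trans)
qed simp

text \<open>The norm is a supremum over all tagged sub-partitions, so smallness of the norm bounds
  all Riemann sums at once.\<close>

lemma uniform_limit_riemann_sum:
  assumes "(\<lambda>n. HK_norm M (u n - l)) \<longlonglongrightarrow> 0"
  shows "uniform_limit (tagged_sub_partitions M) (\<lambda>n. riemann_sum M (u n)) (riemann_sum M l) sequentially"
proof (rule uniform_limitI)
  fix e :: real assume "0 < e"
  then have "\<forall>\<^sub>F n in sequentially. HK_norm M (u n - l) < ennreal e"
    by (intro order_tendstoD(2)[OF assms]) simp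
  then show "\<forall>\<^sub>F n in sequentially. \<forall>P\<in>tagged_sub_partitions M.
      dist (riemann_sum M (u n) P) (riemann_sum M l P) < e"
  proof (rule eventually_mono, intro ballI)
    fix n P assume "HK_norm M (u n - l) < ennreal e" "P \<in> tagged_sub_partitions M"
    then have "ennreal (norm (riemann_sum M (u n - l) P)) < ennreal e"
      by (metis norm_riemann_sum_le_HK_norm le_less_trans)
    then show "dist (riemann_sum M (u n) P) (riemann_sum M l P) < e"
      by (simp add: riemann_sum_diff dist_norm ennreal_less_iff)
  qed
qed

theorem theorem2p6:
  fixes M :: "'a measure"
  assumes "finite_measure M"
    and "complete_measure M"
  shows "complete_wrt (HK_norm M) (HK_space M :: ('a \<Rightarrow> 'b::banach) set)"
  unfolding complete_wrt_def
proof (intro allI impI, elim conjE)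
  fix u :: "nat \<Rightarrow> 'a \<Rightarrow> 'b"
  assume "range u \<subseteq> HK_space M" and cauchy: "Cauchy_wrt (HK_norm M) u"
  then have "\<forall>n. \<exists>I. has_HK_integral M (u n) I"
    by (auto simp: HK_space_def)
  then obtain I where I: "\<And>n. has_HK_integral M (u n) (I n)"
    by metis
  let ?l = "\<lambda>x. lim (\<lambda>n. u n x)"
  have lim: "(\<lambda>n. HK_norm M (u n - ?l)) \<longlonglongrightarrow> 0"
    using cauchy riemann_sum_tendsto_pointwise_lim[OF cauchy] by (rule HK_norm_diff_tendsto_0)
  \<comment> \<open>Norm convergence was obtained without knowing that the limit is integrable, so
    it may be used to prove integrability.\<close>
  from has_HK_integral_uniform_limit[OF I uniform_limit_riemann_sum[OF lim]]
  have "?l \<in> HK_space M"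
    by (simp add: HK_space_def)
  with lim show "\<exists>l\<in>HK_space M. (\<lambda>n. HK_norm M (u n - l)) \<longlonglongrightarrow> 0"
    by blast
qed

end
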